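(* Let $k$ be a field of characteristic $0$ and let $N\langle x,y,z\rangle$ be the free Novikov algebra (with identity) over $k$ in three variables $x,y,z$, with product $\circ$. Put $$w_0=\tfrac12\,(2\,y\circ y-x\circ z-z\circ x)\in N\langle x,y,z\rangle .$$ Then the derivation $$D_1=(2\,y\circ w_0)\,\partial_x+(z\circ w_0)\,\partial_y$$ of $N\langle x,y,z\rangle$, i.e. the derivation with $D_1(x)=2\,y\circ w_0$, $D_1(y)=z\circ w_0$, $D_1(z)=0$, is not triangulable.
   Context: A (left) Novikov algebra over $k$ is a (non-associative) $k$-algebra $(A,\circ)$ satisfying $(a\circ b)\circ c-a\circ(b\circ c)=(b\circ a)\circ c-b\circ(a\circ c)$ and $(a\circ b)\circ c=(a\circ c)\circ b$ for all $a,b,c\in A$. Let $k\{x,y,z\}$ be the algebra of differential polynomials over $k$ in $x,y,z$ with a single derivation $\delta$ (zero on $k$): the commutative polynomial algebra over $k$ in the variables $x^{(r)},y^{(r)},z^{(r)}$, $r\ge 0$, with $\delta(x^{(r)})=x^{(r+1)}$ and similarly for $y,z$; here $x^{(0)}=x$ etc., and $f'=\delta(f)$. With the product $f\circ g=f g'$ this space is a Novikov algebra. Let $N_0\langle x,y,z\rangle$ be the subalgebra of $(k\{x,y,z\},\circ)$ generated by $x,y,z$; since $\operatorname{char} k=0$, it is (a model of) the free Novikov algebra without identity on $x,y,z$. The algebra $N\langle x,y,z\rangle=k\oplus N_0\langle x,y,z\rangle$ is obtained from $N_0\langle x,y,z\rangle$ by formally adjoining an identity element $1$ (so $1\circ f=f\circ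 1=f$ in $N\langle x,y,z\rangle$); this is what is called the free Novikov algebra with identity in $x,y,z$. For a subset of the variables, e.g. $\{y,z\}$ or $\{z\}$, $N\langle y,z\rangle$ and $N\langle z\rangle$ denote the analogous algebras, viewed as the subalgebras of $N\langle x,y,z\rangle$ generated by $1$ and the indicated variables. A derivation of $N\langle x,y,z\rangle$ is a $k$-linear map $d$ with $d(f\circ g)=d(f)\circ g+f\circ d(g)$. It is determined by its values on $x,y,z$, and $d=f_1\partial_x+f_2\partial_y+f_3\partial_z$ denotes the derivation with $d(x)=f_1$, $d(y)=f_2$, $d(z)=f_3$ (omitted terms are zero). A derivation $d$ of $N\langle x,y,z\rangle$ is triangular if $d(x)\in N\langle y,z\rangle$, $d(y)\in N\langle z\rangle$ and $d(z)\in k$. A derivation $d$ is triangulable if there is a $k$-algebra automorphism $\phi$ of $N\langle x,y,z\rangle$ such that $\phi^{-1}d\phi$ is triangular. *)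

theory Defs
  imports Complex_Main "HOL-Library.Poly_Mapping"
begin

section \<open>Differential polynomials in three variables\<close>

datatype var = X | Y | Z

text \<open>
  The indeterminate \<open>(v, r)\<close> stands for the \<open>r\<close>-th derivative of the variable \<open>v\<close>; a differential
  polynomial is an element of the monoid algebra over the free commutative monoid on these
  indeterminates.
\<close>

type_synonym dmonom = "(var \<times> nat) \<Rightarrow>\<^sub>0 nat"
type_synonym 'k dpoly = "dmonom \<Rightarrow>\<^sub>0 'k"

definition dconst :: "'k::field \<Rightarrow> 'k dpoly"
  where "dconst c = Poly_Mapping.single 0 c"

definition dvar :: "var \<Rightarrow> nat \<Rightarrow> 'k::field dpoly"
  where "dvar v r = Poly_Mapping.single (Poly_Mapping.single (v, r) 1) 1"

text \<open>
  The derivation of the term \<open>c m\<close>: each indeterminate \<open>(v, r)\<close> of exponent \<open>e\<close> in \<open>m\<close>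
  contributes \<open>e c\<close> times \<open>m\<close> with one factor \<open>(v, r)\<close> replaced by \<open>(v, r + 1)\<close>.
  The lemmas \<open>delta_dconst\<close>, \<open>delta_dvar\<close>, \<open>delta_add\<close> and \<open>delta_mult\<close> below characterise
  \<open>delta\<close>.
\<close>

definition delta_term :: "dmonom \<Rightarrow> 'k::field \<Rightarrow> 'k dpoly"
  where "delta_term m c =
    (\<Sum>u\<in>Poly_Mapping.keys m.
       Poly_Mapping.single
         (m - Poly_Mapping.single u 1 + Poly_Mapping.single (fst u, Suc (snd u)) 1)
         (of_nat (Poly_Mapping.lookup m u) * c))"

definition delta :: "'k::field dpoly \<Rightarrow> 'k dpoly"
  where "delta f = (\<Sum>m\<in>Poly_Mapping.keys f. delta_term m (Poly_Mapping.lookup f m))"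

lemma delta_term_zero [simp]: "delta_term m 0 = 0"
  by (simp add: delta_term_def)

lemma delta_term_add: "delta_term m (a + b) = delta_term m a + delta_term m b"
  by (simp add: delta_term_def single_add distrib_left sum.distrib)

lemma delta_term_superset:
  assumes "finite S" "Poly_Mapping.keys m \<subseteq> S"
  shows "delta_term m c =
    (\<Sum>u\<in>S. Poly_Mapping.single
         (m - Poly_Mapping.single u 1 + Poly_Mapping.single (fst u, Suc (snd u)) 1)
         (of_nat (Poly_Mapping.lookup m u) * c))"
  unfolding delta_term_def using assms
  by (intro sum.mono_neutral_left) (auto simp: in_keys_iff)

lemma delta_single: "delta (Poly_Mapping.single m c) = delta_term m c"
  by (cases "c = 0") (simp_all add: delta_def)

lemma delta_zero [simp]: "delta 0 = 0"
  by (simp add: delta_def)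

lemma delta_add: "delta (f + g) = delta f + delta g"
  unfolding delta_def
  by (rule setsum_keys_plus_distrib) (simp_all add: delta_term_add)

lemma delta_sum: "delta (sum f S) = (\<Sum>i\<in>S. delta (f i))"
  by (induction S rule: infinite_finite_induct) (simp_all add: delta_add)

lemma delta_dconst [simp]: "delta (dconst c) = 0"
  by (simp add: dconst_def delta_single delta_term_def)

lemma delta_dvar [simp]: "delta (dvar v r) = dvar v (Suc r)"
  by (simp add: dvar_def delta_single delta_term_def)

lemma delta_term_mult:
  "delta_term (m + n) (a * b) =
     delta_term m a * Poly_Mapping.single n b + Poly_Mapping.single m a * delta_term n b"
proof -
  let ?S = "Poly_Mapping.keys m \<union> Poly_Mapping.keys n"
  let ?q = "\<lambda>u :: var \<times> nat. Poly_Mapping.single (fst u, Suc (snd u)) (1::nat)"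
  have sub: "Poly_Mapping.keys (m + n) \<subseteq> ?S"
    by (rule keys_add)
  have *: "Poly_Mapping.single (m + n - Poly_Mapping.single u 1 + ?q u)
        (of_nat (Poly_Mapping.lookup (m + n) u) * (a * b)) =
      Poly_Mapping.single (m - Poly_Mapping.single u 1 + ?q u)
        (of_nat (Poly_Mapping.lookup m u) * a) * Poly_Mapping.single n b +
      Poly_Mapping.single m a * Poly_Mapping.single (n - Poly_Mapping.single u 1 + ?q u)
        (of_nat (Poly_Mapping.lookup n u) * b)" (is "?L = ?A + ?B") for u
  proof -
    have m: "m + n - Poly_Mapping.single u 1 + ?q u = m - Poly_Mapping.single u 1 + ?q u + n"
      if "Poly_Mapping.lookup m u \<noteq> 0"
      using that by (intro poly_mapping_eqI) (auto simp: lookup_add lookup_minus lookup_single when_def)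
    have n: "m + n - Poly_Mapping.single u 1 + ?q u = m + (n - Poly_Mapping.single u 1 + ?q u)"
      if "Poly_Mapping.lookup n u \<noteq> 0"
      using that by (intro poly_mapping_eqI) (auto simp: lookup_add lookup_minus lookup_single when_def)
    have A: "?A = Poly_Mapping.single (m + n - Poly_Mapping.single u 1 + ?q u)
        (of_nat (Poly_Mapping.lookup m u) * (a * b))"
    proof (cases "Poly_Mapping.lookup m u = 0")
      case False
      show ?thesis
        unfolding m[OF False] mult_single by (simp only: ac_simps)
    qed simp
    have B: "?B = Poly_Mapping.single (m + n - Poly_Mapping.single u 1 + ?q u)
        (of_nat (Poly_Mapping.lookup n u) * (a * b))"
    proof (cases "Poly_Mapping.lookup n u = 0")
      case False
      show ?thesis
        unfolding n[OF False] mult_single by (simp only: ac_simps)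
    qed simp
    show ?thesis
      unfolding A B by (simp add: lookup_add distrib_right single_add)
  qed
  show ?thesis
    unfolding delta_term_superset[OF _ sub, simplified]
      delta_term_superset[of ?S m, simplified] delta_term_superset[of ?S n, simplified]
    using * by (simp add: sum_distrib_left sum_distrib_right sum.distrib)
qed

lemma dpoly_expand:
  "f = (\<Sum>m\<in>Poly_Mapping.keys f. Poly_Mapping.single m (Poly_Mapping.lookup f m))"
proof (rule poly_mapping_eqI)
  fix n
  show "Poly_Mapping.lookup f n =
    Poly_Mapping.lookup (\<Sum>m\<in>Poly_Mapping.keys f. Poly_Mapping.single m (Poly_Mapping.lookup f m)) n"
    by (simp add: lookup_sum lookup_single when_def in_keys_iff)
qed

lemma delta_mult: "delta (f * g) = delta f * g + f * delta g"
proof -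
  have 1: "delta (Poly_Mapping.single m a * g) =
      delta_term m a * g + Poly_Mapping.single m a * delta g" for m and a
  proof -
    have "delta (Poly_Mapping.single m a * g) =
      delta (Poly_Mapping.single m a *
        (\<Sum>n\<in>Poly_Mapping.keys g. Poly_Mapping.single n (Poly_Mapping.lookup g n)))"
      using dpoly_expand[of g] by simp
    also have "\<dots> = (\<Sum>n\<in>Poly_Mapping.keys g. delta_term m a * Poly_Mapping.single n (Poly_Mapping.lookup g n)
        + Poly_Mapping.single m a * delta_term n (Poly_Mapping.lookup g n))"
      by (simp add: sum_distrib_left delta_sum mult_single delta_single delta_term_mult)
    also have "\<dots> = delta_term m a * g + Poly_Mapping.single m a * delta g"
      using dpoly_expand[of g] by (simp add: sum.distrib delta_def flip: sum_distrib_left)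
    finally show ?thesis .
  qed
  have "delta (f * g) = delta
      ((\<Sum>m\<in>Poly_Mapping.keys f. Poly_Mapping.single m (Poly_Mapping.lookup f m)) * g)"
    using dpoly_expand[of f] by simp
  also have "\<dots> = (\<Sum>m\<in>Poly_Mapping.keys f. delta_term m (Poly_Mapping.lookup f m) * g
      + Poly_Mapping.single m (Poly_Mapping.lookup f m) * delta g)"
    by (simp add: sum_distrib_right delta_sum 1)
  also have "\<dots> = delta f * g + f * delta g"
    using dpoly_expand[of f] by (simp add: sum.distrib delta_def flip: sum_distrib_right)
  finally show ?thesis .
qed

section \<open>The free Novikov algebra without identity\<close>

definition dprod :: "'k::field dpoly \<Rightarrow> 'k dpoly \<Rightarrow> 'k dpoly"
  where "dprod f g = f * delta g"

lemma dprod_left_symmetric: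
  "dprod (dprod a b) c - dprod a (dprod b c) = dprod (dprod b a) c - dprod b (dprod a c)"
  by (simp add: dprod_def delta_mult algebra_simps)

lemma dprod_right_commute: "dprod (dprod a b) c = dprod (dprod a c) b"
  by (simp add: dprod_def algebra_simps)

inductive_set N0 :: "'k::field dpoly set" where
  var: "dvar v 0 \<in> N0"
| add: "f \<in> N0 \<Longrightarrow> g \<in> N0 \<Longrightarrow> f + g \<in> N0"
| scale: "f \<in> N0 \<Longrightarrow> dconst c * f \<in> N0"
| prod: "f \<in> N0 \<Longrightarrow> g \<in> N0 \<Longrightarrow> dprod f g \<in> N0"

lemma dconst_add: "dconst (a + b) = dconst a + dconst b"
  and dconst_mult: "dconst (a * b) = dconst a * dconst b"
  and dconst_minus: "dconst (- a) = - dconst a"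
  and dconst_0 [simp]: "dconst 0 = 0"
  and dconst_1 [simp]: "dconst 1 = 1"
  by (simp_all add: dconst_def single_add mult_single single_uminus)

lemma N0_zero: "0 \<in> N0"
  using N0.scale[OF N0.var, of 0] by simp

lemma N0_uminus: "f \<in> N0 \<Longrightarrow> - f \<in> N0"
  using N0.scale[of f "-1"] by (simp add: dconst_minus)

lemma N0_diff: "f \<in> N0 \<Longrightarrow> g \<in> N0 \<Longrightarrow> f - g \<in> N0"
  using N0.add[of f "- g"] N0_uminus[of g] by simp

section \<open>The free Novikov algebra with identity\<close>

text \<open>The pair \<open>(a, f)\<close> stands for \<open>a 1 + f\<close>, where \<open>1\<close> is the formally adjoined identity.\<close>

typedef (overloaded) 'k novikov = "{p :: 'k::field \<times> 'k dpoly. snd p \<in> N0}"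
  by (auto intro!: exI[of _ "(0, 0)"] N0_zero)

setup_lifting type_definition_novikov

instantiation novikov :: (field) "{ab_group_add, one}"
begin

lift_definition zero_novikov :: "'a novikov" is "(0, 0)"
  by (simp add: N0_zero)

lift_definition one_novikov :: "'a novikov" is "(1, 0)"
  by (simp add: N0_zero)

lift_definition plus_novikov :: "'a novikov \<Rightarrow> 'a novikov \<Rightarrow> 'a novikov"
  is "\<lambda>(a, f) (b, g). (a + b, f + g)"
  by (auto intro: N0.add)

lift_definition uminus_novikov :: "'a novikov \<Rightarrow> 'a novikov"
  is "\<lambda>(a, f). (- a, - f)"
  by (auto intro: N0_uminus)

lift_definition minus_novikov :: "'a novikov \<Rightarrow> 'a novikov \<Rightarrow> 'a novikov"
  is "\<lambda>(a, f) (b, g). (a - b, f - g)"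
  by (auto intro: N0_diff)

instance
  by standard (transfer; force)+

end

lift_definition nscale :: "'k::field \<Rightarrow> 'k novikov \<Rightarrow> 'k novikov"  (infixr \<open>*\<^sub>N\<close> 75)
  is "\<lambda>c (a, f). (c * a, dconst c * f)"
  by (auto intro: N0.scale)

lift_definition nprod :: "'k::field novikov \<Rightarrow> 'k novikov \<Rightarrow> 'k novikov"  (infixl \<open>\<circ>\<^sub>N\<close> 76)
  is "\<lambda>(a, f) (b, g). (a * b, dconst a * g + dconst b * f + dprod f g)"
  by (auto intro!: N0.add N0.scale N0.prod)

lift_definition nvar :: "var \<Rightarrow> 'k::field novikov" is "\<lambda>v. (0, dvar v 0)"
  by (simp add: N0.var)

interpretation novikov: vector_space nscale
  by standard (transfer; auto simp: dconst_add dconst_mult algebra_simps)+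

lemma nprod_one [simp]: "1 \<circ>\<^sub>N f = f" "f \<circ>\<^sub>N 1 = f"
  by (transfer; auto simp: dprod_def)+

section \<open>Derivations and automorphisms\<close>

inductive_set nsubalg :: "'k::field novikov set \<Rightarrow> 'k novikov set" for S where
  one: "1 \<in> nsubalg S"
| base: "f \<in> S \<Longrightarrow> f \<in> nsubalg S"
| add: "f \<in> nsubalg S \<Longrightarrow> g \<in> nsubalg S \<Longrightarrow> f + g \<in> nsubalg S"
| scale: "f \<in> nsubalg S \<Longrightarrow> c *\<^sub>N f \<in> nsubalg S"
| prod: "f \<in> nsubalg S \<Longrightarrow> g \<in> nsubalg S \<Longrightarrow> f \<circ>\<^sub>N g \<in> nsubalg S"

definition derivation :: "('k::field novikov \<Rightarrow> 'k novikov) \<Rightarrow> bool"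
  where "derivation d \<longleftrightarrow> Vector_Spaces.linear nscale nscale d \<and>
    (\<forall>f g. d (f \<circ>\<^sub>N g) = d f \<circ>\<^sub>N g + f \<circ>\<^sub>N d g)"

definition automorphism :: "('k::field novikov \<Rightarrow> 'k novikov) \<Rightarrow> bool"
  where "automorphism \<phi> \<longleftrightarrow> Vector_Spaces.linear nscale nscale \<phi> \<and> bij \<phi> \<and> \<phi> 1 = 1 \<and>
    (\<forall>f g. \<phi> (f \<circ>\<^sub>N g) = \<phi> f \<circ>\<^sub>N \<phi> g)"

definition triangular :: "('k::field novikov \<Rightarrow> 'k novikov) \<Rightarrow> bool"
  where "triangular d \<longleftrightarrow> derivation d \<and>
    d (nvar X) \<in> nsubalg {nvar Y, nvar Z} \<and>
    d (nvar Y) \<in> nsubalg {nvar Z} \<and>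
    d (nvar Z) \<in> range (\<lambda>c. c *\<^sub>N 1)"

definition triangulable :: "('k::field novikov \<Rightarrow> 'k novikov) \<Rightarrow> bool"
  where "triangulable d \<longleftrightarrow> derivation d \<and>
    (\<exists>\<phi>. automorphism \<phi> \<and> triangular (inv \<phi> \<circ> d \<circ> \<phi>))"

definition w0 :: "'k::field novikov"
  where "w0 = (1 / 2) *\<^sub>N (2 *\<^sub>N (nvar Y \<circ>\<^sub>N nvar Y) - nvar X \<circ>\<^sub>N nvar Z - nvar Z \<circ>\<^sub>N nvar X)"

text \<open>\<open>has_values d f\<^sub>1 f\<^sub>2 f\<^sub>3\<close> says that \<open>d\<close> is the derivation
  \<open>f\<^sub>1 \<partial>\<^sub>x + f\<^sub>2 \<partial>\<^sub>y + f\<^sub>3 \<partial>\<^sub>z\<close>.\<close>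

definition has_values ::
    "('k::field novikov \<Rightarrow> 'k novikov) \<Rightarrow> 'k novikov \<Rightarrow> 'k novikov \<Rightarrow> 'k novikov \<Rightarrow> bool"
  where "has_values d f\<^sub>1 f\<^sub>2 f\<^sub>3 \<longleftrightarrow>
    derivation d \<and> d (nvar X) = f\<^sub>1 \<and> d (nvar Y) = f\<^sub>2 \<and> d (nvar Z) = f\<^sub>3"

end

theory Submission
  imports Defs
begin

text \<open>
  Differential polynomials are filtered by the lowest degree of their monomials, \<open>filt d\<close> being those
  of order at least \<open>d\<close>. Every element of \<open>N0\<close> has order at least \<open>1\<close>, and modulo order \<open>2\<close> it is a
  linear form \<open>a x + b y + c z\<close>, because a proper product has order at least \<open>2\<close>.

  Automorphisms respect the splitting of the algebra into multiples of the identity and \<open>N0\<close>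
  (\<open>automorphism_cst\<close>), and they respect order \<open>2\<close>, so that they act on linear parts by an invertible
  linear map (\<open>automorphism_filt_2_iff\<close>). The derivation \<open>D\<^sub>1\<close> is homogeneous: as \<open>w\<^sub>0\<close> is quadratic, it
  raises the degree by two, and it sends \<open>a x + b y + c z\<close> to \<open>(2 a y + b z) w\<^sub>0'\<close>.

  Suppose that \<open>\<phi>\<^sup>-\<^sup>1 D\<^sub>1 \<phi>\<close> is triangular. Then \<open>D\<^sub>1 (\<phi> z)\<close> is a multiple of \<open>1\<close>; values of \<open>D\<^sub>1\<close> lie
  in \<open>N0\<close>, hence \<open>D\<^sub>1 (\<phi> z) = 0\<close>, and the cubic part of this equation shows that the linear part of
  \<open>\<phi> z\<close> is \<open>c z\<close>. Also \<open>D\<^sub>1 (\<phi> y)\<close> is \<open>\<phi> g\<close> for some \<open>g\<close> generated by \<open>1\<close> and \<open>z\<close>, and it has order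
  at least \<open>3\<close>. The lowest homogeneous part of \<open>\<phi> g\<close> is \<open>g\<close>'s lowest part evaluated at \<open>c z\<close>; so the
  cubic part \<open>(2 a' y + b' z) w\<^sub>0'\<close> of \<open>D\<^sub>1 (\<phi> y)\<close>, where \<open>a' x + b' y + c' z\<close> is the linear part of
  \<open>\<phi> y\<close>, involves only derivatives of \<open>z\<close> (\<open>automorphism_trunc_form\<close>). But \<open>w\<^sub>0'\<close> involves \<open>x''\<close>, so
  \<open>a' = b' = 0\<close> (\<open>w0_leading_part\<close>). Then \<open>\<phi> y\<close> and \<open>\<phi> z\<close> have proportional linear parts, which
  contradicts invertibility on linear parts.
\<close>

section \<open>Differential polynomials: induction, derivations, order\<close>

definition mdeg :: "dmonom \<Rightarrow> nat"
  where "mdeg m = (\<Sum>u\<in>Poly_Mapping.keys m. Poly_Mapping.lookup m u)"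

lemma mdeg_0 [simp]: "mdeg 0 = 0"
  by (simp add: mdeg_def)

lemma mdeg_single [simp]: "mdeg (Poly_Mapping.single u k) = k"
  by (cases "k = 0") (simp_all add: mdeg_def)

lemma mdeg_add: "mdeg (m + n) = mdeg m + mdeg n"
  unfolding mdeg_def by (rule setsum_keys_plus_distrib) simp_all

lemma monom_split:
  assumes "u \<in> Poly_Mapping.keys (m :: dmonom)"
  shows "m = (m - Poly_Mapping.single u 1) + Poly_Mapping.single u 1"
  using assms
  by (intro poly_mapping_eqI) (auto simp: lookup_add lookup_minus lookup_single when_def in_keys_iff)

lemma mdeg_minus_single:
  assumes "u \<in> Poly_Mapping.keys m"
  shows "mdeg m = Suc (mdeg (m - Poly_Mapping.single u 1))"
  using arg_cong[OF monom_split[OF assms], of mdeg] by (simp add: mdeg_add)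

lemma dpoly_add_induct [case_names single add]:
  assumes single: "\<And>m c. P (Poly_Mapping.single m c)"
    and add: "\<And>f g. P f \<Longrightarrow> P g \<Longrightarrow> P (f + g)"
  shows "P (f :: 'k::field dpoly)"
proof -
  have "P (\<Sum>m\<in>S. Poly_Mapping.single m (c m))" for S and c :: "dmonom \<Rightarrow> 'k"
  proof (induction S rule: infinite_finite_induct)
    case (insert m S)
    then show ?case using single add by simp
  qed (use single[of 0 0] in simp_all)
  then show ?thesis
    using dpoly_expand[of f] by metis
qed

lemma dpoly_induct [case_names dconst dvar add mult]:
  assumes dconst: "\<And>c. P (dconst c)"
    and dvar: "\<And>v r. P (dvar v r)"
    and add: "\<And>f g. P f \<Longrightarrow> P g \<Longrightarrow> P (f + g)"
    and mult: "\<And>f g. P f \<Longrightarrow> P g \<Longrightarrow> P (f * g)"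
  shows "P (f :: 'k::field dpoly)"
proof (induction f rule: dpoly_add_induct)
  case (single m c)
  show ?case
  proof (induction "mdeg m" arbitrary: m rule: less_induct)
    case less
    show ?case
    proof (cases "Poly_Mapping.keys m = {}")
      case True
      then have "m = 0" by simp
      then show ?thesis using dconst[of c] by (simp add: dconst_def)
    next
      case False
      then obtain u where u: "u \<in> Poly_Mapping.keys m" by blast
      have "P (Poly_Mapping.single (m - Poly_Mapping.single u 1) c * dvar (fst u) (snd u))"
        using less mdeg_minus_single[OF u] dvar by (intro mult) simp_all
      also have "Poly_Mapping.single (m - Poly_Mapping.single u 1) c * dvar (fst u) (snd u)
          = Poly_Mapping.single m c"
        using monom_split[OF u] by (simp add: dvar_def mult_single)
      finally show ?thesis .
    qed
  qed
qed (rule add)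

text \<open>
  \<open>der h\<close> is the derivation of the polynomial algebra with prescribed values on the indeterminates.
  Partial derivatives, \<open>delta\<close> itself, the Euler operator of a variable and the
  extension of a derivation of the Novikov algebra are all of this form, so one order
  estimate, \<open>der_filt\<close>, serves them all.
\<close>

definition der_term :: "(var \<times> nat \<Rightarrow> 'k dpoly) \<Rightarrow> dmonom \<Rightarrow> 'k::field \<Rightarrow> 'k dpoly"
  where "der_term h m c =
    (\<Sum>u\<in>Poly_Mapping.keys m.
       Poly_Mapping.single (m - Poly_Mapping.single u 1) (of_nat (Poly_Mapping.lookup m u) * c) * h u)"

definition der :: "(var \<times> nat \<Rightarrow> 'k dpoly) \<Rightarrow> 'k::field dpoly \<Rightarrow> 'k dpoly"
  where "der h f = (\<Sum>m\<in>Poly_Mapping.keys f. der_term h m (Poly_Mapping.lookup f m))"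

lemma der_term_zero [simp]: "der_term h m 0 = 0"
  by (simp add: der_term_def)

lemma der_term_add: "der_term h m (a + b) = der_term h m a + der_term h m b"
  by (simp add: der_term_def single_add distrib_left distrib_right sum.distrib)

lemma der_term_superset:
  assumes "finite S" "Poly_Mapping.keys m \<subseteq> S"
  shows "der_term h m c =
    (\<Sum>u\<in>S. Poly_Mapping.single (m - Poly_Mapping.single u 1)
       (of_nat (Poly_Mapping.lookup m u) * c) * h u)"
  unfolding der_term_def using assms
  by (intro sum.mono_neutral_left) (auto simp: in_keys_iff)

lemma der_single: "der h (Poly_Mapping.single m c) = der_term h m c"
  by (cases "c = 0") (simp_all add: der_def)

lemma der_add [simp]: "der h (f + g) = der h f + der h g"
  unfolding der_def by (rule setsum_keys_plus_distrib) (simp_all add: der_term_add)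

lemma der_zero [simp]: "der h 0 = 0"
  by (simp add: der_def)

lemma der_minus [simp]: "der h (- f) = - der h f"
  using der_add[of h f "- f"] by (simp add: minus_unique)

lemma der_diff [simp]: "der h (f - g) = der h f - der h g"
  using der_add[of h f "- g"] by simp

lemma der_dconst [simp]: "der h (dconst c) = 0"
  by (simp add: dconst_def der_single der_term_def)

lemma der_one [simp]: "der h 1 = 0"
  using der_dconst[of h 1] by simp

lemma der_numeral [simp]: "der h (numeral n) = 0"
  by (induction n) (simp_all only: numeral_One numeral_Bit0 numeral_Bit1 der_add der_one add_0_left)

lemma der_dvar [simp]: "der h (dvar v r) = h (v, r)"
  by (simp add: dvar_def der_single der_term_def)

lemma der_term_mult:
  "der_term h (m + n) (a * b) =
     der_term h m a * Poly_Mapping.single n b + Poly_Mapping.single m a * der_term h n b"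
proof -
  let ?S = "Poly_Mapping.keys m \<union> Poly_Mapping.keys n"
  let ?s = "\<lambda>(m::dmonom) u. m - Poly_Mapping.single u 1"
  have sub: "Poly_Mapping.keys (m + n) \<subseteq> ?S"
    by (rule keys_add)
  have *: "Poly_Mapping.single (?s (m + n) u) (of_nat (Poly_Mapping.lookup (m + n) u) * (a * b)) * h u =
      Poly_Mapping.single (?s m u) (of_nat (Poly_Mapping.lookup m u) * a) * h u * Poly_Mapping.single n b +
      Poly_Mapping.single m a * (Poly_Mapping.single (?s n u) (of_nat (Poly_Mapping.lookup n u) * b) * h u)"
    (is "?L = ?A + ?B") for u
  proof -
    have A: "?A = Poly_Mapping.single (?s (m + n) u) (of_nat (Poly_Mapping.lookup m u) * (a * b)) * h u"
    proof (cases "Poly_Mapping.lookup m u = 0")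
      case False
      then have "?s (m + n) u = ?s m u + n"
        by (intro poly_mapping_eqI) (auto simp: lookup_add lookup_minus lookup_single when_def)
      then show ?thesis
        by (simp add: mult_single ac_simps flip: mult.assoc)
    qed simp
    have B: "?B = Poly_Mapping.single (?s (m + n) u) (of_nat (Poly_Mapping.lookup n u) * (a * b)) * h u"
    proof (cases "Poly_Mapping.lookup n u = 0")
      case False
      then have "?s (m + n) u = m + ?s n u"
        by (intro poly_mapping_eqI) (auto simp: lookup_add lookup_minus lookup_single when_def)
      then show ?thesis
        by (simp add: mult_single ac_simps flip: mult.assoc)
    qed simp
    show ?thesis
      unfolding A B by (simp add: lookup_add distrib_right single_add)
  qed
  show ?thesis
    unfolding der_term_superset[OF _ sub, simplified]
      der_term_superset[of ?S m, simplified] der_term_superset[of ?S n, simplified]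
    using * by (simp add: sum_distrib_left sum_distrib_right sum.distrib)
qed

lemma der_mult [simp]: "der h (f * g) = der h f * g + f * der h g"
proof (induction f rule: dpoly_add_induct)
  case (single m a)
  show ?case
  proof (induction g rule: dpoly_add_induct)
    case (single n b)
    show ?case by (simp add: mult_single der_single der_term_mult)
  qed (simp add: algebra_simps)
qed (simp add: algebra_simps)

text \<open>
  The commutator of two derivations is a derivation, so its vanishing can be tested on indeterminates.
\<close>

lemma der_delta_commute:
  assumes "\<And>v r. h (v, Suc r) = delta (h (v, r))"
  shows "der h (delta f) = delta (der h f)"
  by (induction f rule: dpoly_induct) (simp_all add: assms delta_add delta_mult algebra_simps)

lemma delta_eq_der: "delta f = der (\<lambda>(v, r). dvar v (Suc r)) f"
  by (induction f rule: dpoly_induct) (simp_all add: delta_add delta_mult)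

lemma delta_diff: "delta (f - g) = delta f - delta g"
  and delta_minus: "delta (- f) = - delta f"
  by (simp_all add: delta_eq_der)

definition filt :: "nat \<Rightarrow> 'k::field dpoly set"
  where "filt d = {f. \<forall>m\<in>Poly_Mapping.keys f. d \<le> mdeg m}"

lemma filt_0 [simp]: "f \<in> filt 0"
  by (simp add: filt_def)

lemma zero_filt [simp]: "0 \<in> filt d"
  by (simp add: filt_def)

lemma filt_mono: "f \<in> filt d \<Longrightarrow> e \<le> d \<Longrightarrow> f \<in> filt e"
  by (force simp: filt_def)

lemma filt_add: "f \<in> filt d \<Longrightarrow> g \<in> filt d \<Longrightarrow> f + g \<in> filt d"
  using keys_add[of f g] by (fastforce simp: filt_def)

lemma filt_minus: "f \<in> filt d \<Longrightarrow> - f \<in> filt d"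
  by (simp add: filt_def)

lemma filt_diff: "f \<in> filt d \<Longrightarrow> g \<in> filt d \<Longrightarrow> f - g \<in> filt d"
  using filt_add[of f d "- g"] filt_minus[of g d] by simp

lemma filt_sum: "(\<And>i. i \<in> S \<Longrightarrow> f i \<in> filt d) \<Longrightarrow> sum f S \<in> filt d"
  by (induction S rule: infinite_finite_induct) (auto intro: filt_add)

lemma filt_mult: "f \<in> filt d \<Longrightarrow> g \<in> filt e \<Longrightarrow> f * g \<in> filt (d + e)"
  using keys_mult[of f g] by (fastforce simp: filt_def mdeg_add intro: add_mono)

lemma filt_mult_right: "g \<in> filt e \<Longrightarrow> f * g \<in> filt e"
  using filt_mult[OF filt_0[of f]] by simp

lemma single_filt: "d \<le> mdeg m \<Longrightarrow> Poly_Mapping.single m c \<in> filt d"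
  by (simp add: filt_def)

lemma dvar_filt: "dvar v r \<in> filt 1"
  by (simp add: dvar_def single_filt)

lemma dconst_filt_iff: "dconst c \<in> filt 1 \<longleftrightarrow> c = 0"
  by (auto simp: dconst_def filt_def)

text \<open>
  The derivation removes one factor from a monomial and inserts a value of order at least \<open>e\<close>.
\<close>

lemma der_filt:
  assumes "\<And>u. h u \<in> filt e" "f \<in> filt (Suc d)"
  shows "der h f \<in> filt (d + e)"
  unfolding der_def der_term_def
proof (intro filt_sum filt_mult assms(1) single_filt)
  fix m u
  assume m: "m \<in> Poly_Mapping.keys f" and u: "u \<in> Poly_Mapping.keys m"
  have "Suc d \<le> mdeg m"
    using assms(2) m by (simp add: filt_def)
  then show "d \<le> mdeg (m - Poly_Mapping.single u 1)"
    unfolding mdeg_minus_single[OF u] by simp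
qed

lemma delta_filt: "f \<in> filt d \<Longrightarrow> delta f \<in> filt d"
proof (cases d)
  case (Suc e)
  assume "f \<in> filt d"
  then show ?thesis
    using der_filt[of "\<lambda>(v, r). dvar v (Suc r)" 1 f e] Suc dvar_filt
    by (auto simp: delta_eq_der)
qed simp

lemma dprod_filt: "f \<in> filt d \<Longrightarrow> g \<in> filt e \<Longrightarrow> dprod f g \<in> filt (d + e)"
  by (simp add: dprod_def filt_mult delta_filt)

lemma dprod_filt_le: "f \<in> filt d \<Longrightarrow> g \<in> filt e \<Longrightarrow> k \<le> d + e \<Longrightarrow> dprod f g \<in> filt k"
  using filt_mono[OF dprod_filt] .

lemma N0_filt: "f \<in> N0 \<Longrightarrow> f \<in> filt 1"
proof (induction rule: N0.induct)
  case (prod f g)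
  then show ?case by (simp add: dprod_filt_le[of f 1 g 1])
qed (simp_all only: dvar_filt filt_add filt_mult_right)

abbreviation pd :: "var \<Rightarrow> nat \<Rightarrow> 'k::field dpoly \<Rightarrow> 'k dpoly"
  where "pd v r \<equiv> der (\<lambda>u. if u = (v, r) then 1 else 0)"

lemma pd_filt: "f \<in> filt (Suc d) \<Longrightarrow> pd v r f \<in> filt d"
  using der_filt[of "\<lambda>u. if u = (v, r) then 1 else 0" 0] by simp

definition lin :: "'k::field \<Rightarrow> 'k \<Rightarrow> 'k \<Rightarrow> 'k dpoly"
  where "lin a b c = dconst a * dvar X 0 + dconst b * dvar Y 0 + dconst c * dvar Z 0"

lemma lin_filt: "lin a b c \<in> filt 1"
  unfolding lin_def by (intro filt_add filt_mult_right dvar_filt)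

lemma lin_filt_2:
  assumes "lin a b c \<in> filt 2"
  shows "a = 0" "b = 0" "c = 0"
proof -
  have *: "pd v 0 (lin a b c) \<in> filt 1" for v
    using assms by (intro pd_filt) (simp add: numeral_2_eq_2)
  show "a = 0" "b = 0" "c = 0"
    using *[of X] *[of Y] *[of Z] by (simp_all add: lin_def dconst_filt_iff del: One_nat_def)
qed

lemma lin_add: "lin (a + a') (b + b') (c + c') = lin a b c + lin a' b' c'"
  by (simp add: lin_def dconst_add algebra_simps)

lemma lin_scale: "lin (s * a) (s * b) (s * c) = dconst s * lin a b c"
  by (simp add: lin_def dconst_mult algebra_simps)


lemma dconst_cancel:
  assumes "dconst c * f = 0" "c \<noteq> 0"
  shows "f = 0"
proof -
  have "f = dconst (inverse c * c) * f"
    using assms(2) by simp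
  also have "\<dots> = dconst (inverse c) * (dconst c * f)"
    by (simp only: dconst_mult mult.assoc)
  finally show ?thesis
    using assms(1) by simp
qed

section \<open>Components of elements of the algebra with identity\<close>

text \<open>
  The coordinates of \<open>a 1 + f\<close>: \<open>cst\<close> is the scalar \<open>a\<close> and \<open>bod\<close> the differential polynomial \<open>f\<close>.
\<close>

definition cst :: "'k::field novikov \<Rightarrow> 'k"
  where "cst f = fst (Rep_novikov f)"

definition bod :: "'k::field novikov \<Rightarrow> 'k dpoly"
  where "bod f = snd (Rep_novikov f)"

lemmas rep_eqs = zero_novikov.rep_eq one_novikov.rep_eq plus_novikov.rep_eq minus_novikov.rep_eq
  nscale.rep_eq nprod.rep_eq nvar.rep_eq

lemma novikov_eqI: "cst f = cst g \<Longrightarrow> bod f = bod g \<Longrightarrow> f = g"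
  by (simp add: cst_def bod_def Rep_novikov_inject[symmetric] prod_eq_iff)

lemma bod_N0: "bod f \<in> N0"
  using Rep_novikov[of f] by (simp add: bod_def)

lemma cst_simps [simp]:
  "cst 0 = 0" "cst 1 = 1" "cst (nvar v) = 0" "cst (f + g) = cst f + cst g"
  "cst (f - g) = cst f - cst g" "cst (c *\<^sub>N f) = c * cst f" "cst (f \<circ>\<^sub>N g) = cst f * cst g"
  by (simp_all add: cst_def rep_eqs split_beta)

lemma bod_simps [simp]:
  "bod 0 = 0" "bod 1 = 0" "bod (nvar v) = dvar v 0" "bod (f + g) = bod f + bod g"
  "bod (f - g) = bod f - bod g" "bod (c *\<^sub>N f) = dconst c * bod f"
  "bod (f \<circ>\<^sub>N g) = dconst (cst f) * bod g + dconst (cst g) * bod f + dprod (bod f) (bod g)"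
  by (simp_all add: bod_def cst_def rep_eqs split_beta)

definition emb :: "'k::field dpoly \<Rightarrow> 'k novikov"
  where "emb f = Abs_novikov (0, f)"

lemma emb_simps [simp]: "f \<in> N0 \<Longrightarrow> cst (emb f) = 0" "f \<in> N0 \<Longrightarrow> bod (emb f) = f"
  by (simp_all add: cst_def bod_def emb_def Abs_novikov_inverse)

lemma novikov_induct [case_names one var add scale prod]:
  assumes one: "P 1" and var: "\<And>v. P (nvar v)"
    and add: "\<And>f g. P f \<Longrightarrow> P g \<Longrightarrow> P (f + g)"
    and scale: "\<And>c f. P f \<Longrightarrow> P (c *\<^sub>N f)"
    and prod: "\<And>f g. P f \<Longrightarrow> P g \<Longrightarrow> P (f \<circ>\<^sub>N g)"
  shows "P (f :: 'k::field novikov)"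
proof -
  have emb: "P (emb g)" if "g \<in> N0" for g
    using that
  proof (induction rule: N0.induct)
    case (var v)
    have "emb (dvar v 0) = (nvar v :: 'k novikov)"
      by (intro novikov_eqI) (simp_all add: N0.var)
    then show ?case using assms(2) by simp
  next
    case (add f g)
    then have "emb (f + g) = emb f + emb g"
      by (intro novikov_eqI) (simp_all add: N0.add)
    then show ?case using add assms(3) by simp
  next
    case (scale f c)
    then have "emb (dconst c * f) = c *\<^sub>N emb f"
      by (intro novikov_eqI) (simp_all add: N0.scale)
    then show ?case using scale assms(4) by simp
  next
    case (prod f g)
    then have "emb (dprod f g) = emb f \<circ>\<^sub>N emb g"
      by (intro novikov_eqI) (simp_all add: N0.prod)
    then show ?case using prod assms(5) by simp
  qed
  have "f = cst f *\<^sub>N 1 + emb (bod f)"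
    by (intro novikov_eqI) (simp_all add: bod_N0)
  then show ?thesis
    using add[OF scale[OF one] emb[OF bod_N0[of f]]] by metis
qed

section \<open>Derivations\<close>

lemma linear_nscale_iff:
  "Vector_Spaces.linear nscale nscale f \<longleftrightarrow>
    (\<forall>x y. f (x + y) = f x + f y) \<and> (\<forall>c x. f (c *\<^sub>N x) = c *\<^sub>N f x)"
  by (simp add: Vector_Spaces.linear_def module_hom_def module_hom_axioms_def
      novikov.vector_space_axioms novikov.module_axioms)

lemma derivation_iff:
  "derivation d \<longleftrightarrow> (\<forall>f g. d (f + g) = d f + d g) \<and> (\<forall>c f. d (c *\<^sub>N f) = c *\<^sub>N d f) \<and>
    (\<forall>f g. d (f \<circ>\<^sub>N g) = d f \<circ>\<^sub>N g + f \<circ>\<^sub>N d g)"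
  by (simp add: derivation_def linear_nscale_iff)

text \<open>
  The values that a derivation commuting with \<open>delta\<close> must take on the derivatives of the variables.
\<close>

definition prolong :: "(var \<Rightarrow> 'k::field dpoly) \<Rightarrow> var \<times> nat \<Rightarrow> 'k dpoly"
  where "prolong f = (\<lambda>(v, r). (delta ^^ r) (f v))"

lemma der_prolong_delta: "der (prolong f) (delta g) = delta (der (prolong f) g)"
  by (rule der_delta_commute) (simp add: prolong_def)

text \<open>
  A derivation whose values on the variables have no constant part is induced by a derivation of differential
  polynomials that commutes with \<open>delta\<close>. This gives uniqueness, and the degree shift of \<open>D\<^sub>1\<close>
  can be read off from \<open>der_filt\<close>. Conversely, \<open>derivation_exists\<close> restricts such a derivation to \<open>N0\<close>.
\<close>

lemma derivation_bod:
  assumes d: "derivation d" and var: "\<And>v. cst (d (nvar v)) = 0"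
  shows "cst (d f) = 0" "bod (d f) = der (prolong (\<lambda>v. bod (d (nvar v)))) (bod f)"
proof -
  have "d 1 = d 1 + d 1"
    using d nprod_one unfolding derivation_iff by metis
  then have 1: "d 1 = 0" by simp
  have "cst (d f) = 0 \<and> bod (d f) = der (prolong (\<lambda>v. bod (d (nvar v)))) (bod f)"
  proof (induction f rule: novikov_induct)
    case (var v)
    then show ?case using assms(2) by (simp add: prolong_def)
  next
    case (prod f g)
    then show ?case
      using d by (simp add: derivation_iff dprod_def der_prolong_delta algebra_simps)
  qed (use d 1 in \<open>simp_all add: derivation_iff\<close>)
  then show "cst (d f) = 0" "bod (d f) = der (prolong (\<lambda>v. bod (d (nvar v)))) (bod f)"
    by simp_all
qed

lemma derivation_unique:
  assumes "derivation d" "derivation e" "\<And>v. cst (d (nvar v)) = 0" "\<And>v. d (nvar v) = e (nvar v)"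
  shows "d = e"
proof
  fix f
  show "d f = e f"
    using derivation_bod[OF assms(1,3), of f] derivation_bod[OF assms(2), of f] assms(3,4)
    by (intro novikov_eqI) simp_all
qed

lemma derivation_exists:
  assumes cst: "\<And>v. cst (F v) = 0"
  shows "\<exists>d. derivation d \<and> (\<forall>v. d (nvar v) = F v)"
proof (intro exI conjI allI)
  let ?h = "prolong (\<lambda>v. bod (F v))"
  let ?d = "\<lambda>f. emb (der ?h (bod f))"
  have "der ?h f \<in> N0" if "f \<in> N0" for f
    using that
  proof (induction rule: N0.induct)
    case (prod f g)
    then have "der ?h (dprod f g) = dprod (der ?h f) g + dprod f (der ?h g)"
      by (simp add: dprod_def der_prolong_delta)
    then show ?case using prod by (simp add: N0.add N0.prod)
  qed (simp_all add: prolong_def bod_N0 N0.add N0.scale)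
  then have N0: "der ?h (bod f) \<in> N0" for f
    by (simp add: bod_N0)
  show "derivation ?d"
    unfolding derivation_iff
  proof (intro conjI allI)
    fix f g :: "'a novikov" and c
    show "?d (f + g) = ?d f + ?d g"
      using N0[of "f + g"] N0[of f] N0[of g] by (intro novikov_eqI) simp_all
    show "?d (c *\<^sub>N f) = c *\<^sub>N ?d f"
      using N0[of "c *\<^sub>N f"] N0[of f] by (intro novikov_eqI) simp_all
    show "?d (f \<circ>\<^sub>N g) = ?d f \<circ>\<^sub>N g + f \<circ>\<^sub>N ?d g"
    proof (rule novikov_eqI)
      show "cst (?d (f \<circ>\<^sub>N g)) = cst (?d f \<circ>\<^sub>N g + f \<circ>\<^sub>N ?d g)"
        unfolding cst_simps emb_simps(1)[OF N0] by simp
      show "bod (?d (f \<circ>\<^sub>N g)) = bod (?d f \<circ>\<^sub>N g + f \<circ>\<^sub>N ?d g)"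
        unfolding bod_simps(4,7) emb_simps[OF N0] emb_simps(2)[OF N0[of "f \<circ>\<^sub>N g", unfolded bod_simps]]
        by (simp add: dprod_def der_prolong_delta algebra_simps)
    qed
  qed
  fix v
  show "?d (nvar v) = F v"
    using cst[of v] by (intro novikov_eqI) (simp_all add: prolong_def bod_N0)
qed

lemma prolong_filt: "(\<And>v. f v \<in> filt e) \<Longrightarrow> prolong f u \<in> filt e"
proof (cases u)
  case (Pair v r)
  assume "\<And>v. f v \<in> filt e"
  then have "(delta ^^ r) (f v) \<in> filt e"
    by (induction r) (simp_all add: delta_filt)
  then show ?thesis
    by (simp add: prolong_def Pair)
qed

section \<open>Automorphisms\<close>

lemma automorphism_iff:
  "automorphism \<phi> \<longleftrightarrow> (\<forall>f g. \<phi> (f + g) = \<phi> f + \<phi> g) \<and> (\<forall>c f. \<phi> (c *\<^sub>N f) = c *\<^sub>N \<phi> f) \<and>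
    bij \<phi> \<and> \<phi> 1 = 1 \<and> (\<forall>f g. \<phi> (f \<circ>\<^sub>N g) = \<phi> f \<circ>\<^sub>N \<phi> g)"
  by (simp add: automorphism_def linear_nscale_iff)

lemma automorphism_inv:
  assumes "automorphism \<phi>"
  shows "automorphism (inv \<phi>)"
proof -
  have bij: "bij \<phi>"
    using assms by (simp add: automorphism_iff)
  have eq: "inv \<phi> a = b" if "a = \<phi> b" for a b
    using that bij by (simp add: bij_is_inj)
  have r: "\<phi> (inv \<phi> f) = f" for f
    using bij by (simp add: bij_is_surj surj_f_inv_f)
  show ?thesis
    unfolding automorphism_iff
  proof (intro conjI allI)
    show "bij (inv \<phi>)"
      using bij by (rule bij_imp_bij_inv)
  qed (rule eq, use assms in \<open>simp add: automorphism_iff r\<close>)+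
qed

text \<open>
  The identity violates right commutativity: \<open>(v \<circ> y) \<circ> z = (v \<circ> z) \<circ> y\<close> holds for a variable
  \<open>v\<close>, while for \<open>1\<close> in place of \<open>v\<close> it would say \<open>y \<circ> z = z \<circ> y\<close>. Applying \<open>\<phi>\<close>
  to the former therefore multiplies the commutator of \<open>\<phi> y\<close> and \<open>\<phi> z\<close> by the constant part of \<open>\<phi> v\<close>
  and gives zero; the commutator is nonzero since \<open>\<phi>\<close> is injective.
\<close>

lemma automorphism_cst_var:
  assumes aut: "automorphism (\<phi> :: 'k::field novikov \<Rightarrow> 'k novikov)"
  shows "cst (\<phi> (nvar v)) = 0"
proof (rule ccontr)
  assume nz: "cst (\<phi> (nvar v)) \<noteq> 0"
  define V U W where "V = \<phi> (nvar v)" and "U = \<phi> (nvar Y)" and "W = \<phi> (nvar Z)"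
  have "(nvar v \<circ>\<^sub>N nvar Y) \<circ>\<^sub>N nvar Z = (nvar v \<circ>\<^sub>N nvar Z) \<circ>\<^sub>N (nvar Y :: 'k novikov)"
    by (intro novikov_eqI) (simp_all add: dprod_right_commute)
  then have "(V \<circ>\<^sub>N U) \<circ>\<^sub>N W = (V \<circ>\<^sub>N W) \<circ>\<^sub>N U"
    using aut unfolding automorphism_iff V_def U_def W_def by metis
  then have "bod ((V \<circ>\<^sub>N U) \<circ>\<^sub>N W) - bod ((V \<circ>\<^sub>N W) \<circ>\<^sub>N U) = 0"
    by simp
  also have "bod ((V \<circ>\<^sub>N U) \<circ>\<^sub>N W) - bod ((V \<circ>\<^sub>N W) \<circ>\<^sub>N U) =
      dconst (cst V) * (dprod (bod U) (bod W) - dprod (bod W) (bod U))"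
    by (simp add: dconst_mult dprod_def algebra_simps)
  finally have "dprod (bod U) (bod W) = dprod (bod W) (bod U)"
    using dconst_cancel nz V_def by fastforce
  then have "U \<circ>\<^sub>N W = W \<circ>\<^sub>N U"
    by (intro novikov_eqI) simp_all
  then have "\<phi> (nvar Y \<circ>\<^sub>N nvar Z) = \<phi> (nvar Z \<circ>\<^sub>N nvar Y)"
    using aut unfolding automorphism_iff U_def W_def by metis
  then have "nvar Y \<circ>\<^sub>N nvar Z = (nvar Z \<circ>\<^sub>N nvar Y :: 'k novikov)"
    using aut unfolding automorphism_iff by (meson bij_is_inj injD)
  then have "bod (nvar Y \<circ>\<^sub>N nvar Z :: 'k novikov) = bod (nvar Z \<circ>\<^sub>N nvar Y)"
    by simp
  then have "dvar Y 0 * dvar Z 1 = (dvar Z 0 * dvar Y 1 :: 'k dpoly)"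
    by (simp add: dprod_def)
  then have "pd Z 1 (pd Y 0 (dvar Y 0 * dvar Z 1)) = (pd Z 1 (pd Y 0 (dvar Z 0 * dvar Y 1)) :: 'k dpoly)"
    by (rule arg_cong)
  then show False
    by simp
qed

lemma automorphism_cst:
  assumes aut: "automorphism \<phi>"
  shows "cst (\<phi> f) = cst f"
  by (induction f rule: novikov_induct)
    (use aut in \<open>simp_all add: automorphism_iff automorphism_cst_var[OF aut]\<close>)

text \<open>
  Both \<open>f\<close> and \<open>\<phi> f\<close> lose their proper products modulo order \<open>2\<close>, which leaves in \<open>\<phi> f\<close> the
  same combination of the images of the variables as the linear part of \<open>f\<close> is of the variables.
\<close>

lemma automorphism_linear_part:
  assumes aut: "automorphism \<phi>"
  shows "\<exists>a b c. bod f - lin a b c \<in> filt 2 \<and>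
    bod (\<phi> f) - (dconst a * bod (\<phi> (nvar X)) + dconst b * bod (\<phi> (nvar Y)) + dconst c * bod (\<phi> (nvar Z)))
      \<in> filt 2"
proof -
  define G where "G a b c =
    dconst a * bod (\<phi> (nvar X)) + dconst b * bod (\<phi> (nvar Y)) + dconst c * bod (\<phi> (nvar Z))" for a b c
  have G_add: "G (a + a') (b + b') (c + c') = G a b c + G a' b' c'" for a b c a' b' c'
    by (simp add: G_def dconst_add algebra_simps)
  have G_scale: "G (s * a) (s * b) (s * c) = dconst s * G a b c" for s a b c
    by (simp add: G_def dconst_mult algebra_simps)
  define R where "R p q \<longleftrightarrow> (\<exists>a b c. p - lin a b c \<in> filt 2 \<and> q - G a b c \<in> filt 2)" for p q
  have R_add: "R (p + p') (q + q')" if pq: "R p q" "R p' q'" for p q p' q'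
  proof -
    obtain a b c a' b' c' where
      "p - lin a b c \<in> filt 2" "q - G a b c \<in> filt 2" "p' - lin a' b' c' \<in> filt 2" "q' - G a' b' c' \<in> filt 2"
      using pq unfolding R_def by blast
    then have "p - lin a b c + (p' - lin a' b' c') \<in> filt 2" "q - G a b c + (q' - G a' b' c') \<in> filt 2"
      by (auto intro: filt_add)
    then show ?thesis
      unfolding R_def by (intro exI[of _ "a + a'"] exI[of _ "b + b'"] exI[of _ "c + c'"])
        (simp add: lin_add G_add algebra_simps)
  qed
  have R_scale: "R (dconst s * p) (dconst s * q)" if "R p q" for s p q
  proof -
    obtain a b c where "p - lin a b c \<in> filt 2" "q - G a b c \<in> filt 2"
      using \<open>R p q\<close> unfolding R_def by blast
    then have "dconst s * (p - lin a b c) \<in> filt 2" "dconst s * (q - G a b c) \<in> filt 2"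
      by (auto intro: filt_mult_right)
    then show ?thesis
      unfolding R_def by (intro exI[of _ "s * a"] exI[of _ "s * b"] exI[of _ "s * c"])
        (simp only: lin_scale G_scale right_diff_distrib)
  qed
  have R_filt: "R p q" if "p \<in> filt 2" "q \<in> filt 2" for p q
    unfolding R_def using that by (intro exI[of _ 0]) (simp add: lin_def G_def)
  have R_var: "R (dvar v 0) (bod (\<phi> (nvar v)))" for v
  proof (cases v)
    case X show ?thesis unfolding X R_def
      by (intro exI[of _ 1] exI[of _ 0]) (simp add: lin_def G_def)
  next
    case Y show ?thesis unfolding Y R_def
      by (rule exI[of _ 0], rule exI[of _ 1], rule exI[of _ 0]) (simp add: lin_def G_def)
  next
    case Z show ?thesis unfolding Z R_def
      by (rule exI[of _ 0], rule exI[of _ 0], rule exI[of _ 1]) (simp add: lin_def G_def)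
  qed
  have prod_filt: "dprod (bod f) (bod g) \<in> filt 2" for f g :: "'a novikov"
    by (rule dprod_filt_le[OF N0_filt N0_filt, OF bod_N0 bod_N0]) simp
  have "R (bod f) (bod (\<phi> f))"
  proof (induction f rule: novikov_induct)
    case one
    then show ?case using aut by (simp add: automorphism_iff R_filt)
  next
    case (prod f g)
    have "\<phi> (f \<circ>\<^sub>N g) = \<phi> f \<circ>\<^sub>N \<phi> g"
      using aut by (simp add: automorphism_iff)
    then show ?case
      using R_add[OF R_add[OF R_scale[OF prod(2)] R_scale[OF prod(1)]] R_filt[OF prod_filt prod_filt]]
      by (simp add: automorphism_cst[OF aut])
  qed (use aut R_add R_scale R_var in \<open>simp_all add: automorphism_iff\<close>)
  then show ?thesis
    by (simp add: R_def G_def)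
qed

lemma automorphism_filt_2:
  assumes "automorphism \<phi>" "bod f \<in> filt 2"
  shows "bod (\<phi> f) \<in> filt 2"
proof -
  obtain a b c where *: "bod f - lin a b c \<in> filt 2" "bod (\<phi> f) - (dconst a * bod (\<phi> (nvar X)) +
      dconst b * bod (\<phi> (nvar Y)) + dconst c * bod (\<phi> (nvar Z))) \<in> filt 2"
    using automorphism_linear_part[OF assms(1)] by blast
  have "lin a b c \<in> filt 2"
    using filt_diff[OF assms(2) *(1)] by simp
  then have "a = 0" "b = 0" "c = 0"
    by (auto dest: lin_filt_2)
  then show ?thesis
    using *(2) by simp
qed

lemma automorphism_filt_2_iff:
  assumes "automorphism \<phi>"
  shows "bod (\<phi> f) \<in> filt 2 \<longleftrightarrow> bod f \<in> filt 2"
proof -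
  have "inv \<phi> (\<phi> f) = f"
    using assms by (simp add: automorphism_iff bij_is_inj)
  then show ?thesis
    using automorphism_filt_2[OF assms, of f]
      automorphism_filt_2[OF automorphism_inv[OF assms], of "\<phi> f"] by auto
qed


section \<open>The derivation \<open>D\<^sub>1\<close> is not triangulable\<close>

text \<open>
  The Euler operator counting \<open>x\<close> and its derivatives. It vanishes on polynomials free of \<open>x\<close>, and unlike
  a partial derivative it commutes with \<open>delta\<close>, so its kernel is closed under the Novikov
  product; being in this kernel serves as the test for not involving \<open>x\<close>.
\<close>

abbreviation xeuler :: "'k::field dpoly \<Rightarrow> 'k dpoly"
  where "xeuler \<equiv> der (\<lambda>(v, r). if v = X then dvar v r else 0)"

lemma xeuler_delta: "xeuler (delta f) = delta (xeuler f)"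
  by (rule der_delta_commute) simp

lemma xeuler_dprod: "xeuler f = 0 \<Longrightarrow> xeuler g = 0 \<Longrightarrow> xeuler (dprod f g) = 0"
  by (simp add: dprod_def xeuler_delta)

lemma xeuler_filt:
  assumes "f \<in> filt d"
  shows "xeuler f \<in> filt d"
proof (cases d)
  case (Suc e)
  have "xeuler f \<in> filt (e + 1)"
    using assms Suc by (intro der_filt) (auto simp: dvar_filt simp del: One_nat_def)
  then show ?thesis by (simp add: Suc)
qed simp

text \<open>
  The Euler operator eliminates \<open>t\<close> and the part \<open>y y'\<close> of \<open>w\<^sub>0\<close>; then differentiation by \<open>x''\<close> and by
  \<open>z\<close> reduces \<open>(2 a y + b z) w\<^sub>0'\<close> to a nonzero multiple of \<open>a y + b z\<close>. All these operators respect
  orders, so nothing is lost by working modulo order \<open>4\<close>.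
\<close>

lemma w0_leading_part:
  fixes t :: "'k::field_char_0 dpoly"
  assumes t: "xeuler t = 0"
    and filt: "(dconst (2 * a) * dvar Y 0 + dconst b * dvar Z 0) * delta (bod w0) - t \<in> filt 4"
  shows "a = 0" "b = 0"
proof -
  define L where "L = dconst (2 * a) * dvar Y 0 + dconst b * (dvar Z 0 :: 'k dpoly)"
  have L: "xeuler L = 0" "pd X 2 L = 0" "pd Z 0 L = dconst b"
    by (simp_all add: L_def)
  have w0: "bod w0 = dconst (1 / 2) * (dconst 2 * (dvar Y 0 * dvar Y 1) - dvar X 0 * dvar Z 1
      - dvar Z 0 * (dvar X 1 :: 'k dpoly))"
    by (simp add: w0_def dprod_def)
  have "xeuler (L * delta (bod w0) - t) = L * delta (xeuler (bod w0))"
    by (simp add: t L xeuler_delta)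
  then have "L * delta (xeuler (bod w0)) \<in> filt 4"
    using xeuler_filt[OF filt] unfolding L_def by simp
  then have "pd X 2 (L * delta (xeuler (bod w0))) \<in> filt 3"
    by (intro pd_filt) simp
  also have "pd X 2 (L * delta (xeuler (bod w0))) = - (dconst (1 / 2) * (L * dvar Z 0))"
    by (simp add: w0 L delta_diff delta_minus delta_mult)
  finally have "dconst (1 / 2) * (L * dvar Z 0) \<in> filt 3"
    using filt_minus by fastforce
  then have "pd Z 0 (dconst (1 / 2) * (L * dvar Z 0)) \<in> filt 2"
    by (intro pd_filt) (simp add: numeral_3_eq_3 numeral_2_eq_2)
  also have "pd Z 0 (dconst (1 / 2) * (L * dvar Z 0)) = lin 0 a b"
  proof -
    have "pd Z 0 (dconst (1 / 2) * (L * dvar Z 0)) =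
        dconst (1 / 2 * (2 * a)) * dvar Y 0 + dconst (1 / 2 * (b + b)) * dvar Z 0"
      unfolding dconst_mult[of "1/2"] dconst_add by (simp add: L) (simp add: L_def algebra_simps)
    then show ?thesis
      by (simp add: lin_def)
  qed
  finally show "a = 0" "b = 0"
    by (auto dest: lin_filt_2)
qed

text \<open>
  The shape, modulo order \<open>4\<close>, of an element of the Novikov algebra generated by \<open>P\<close>, when the linear
  part of \<open>P\<close> is free of \<open>x\<close>: in a triple product of copies of \<open>P\<close> only this linear part matters, whereas
  \<open>P\<close> and \<open>P \<circ> P\<close> contribute terms of higher degree that may involve \<open>x\<close> and have to be kept.
\<close>

definition trunc_form :: "'k::field dpoly \<Rightarrow> 'k dpoly \<Rightarrow> bool"
  where "trunc_form P h \<longleftrightarrow> (\<exists>\<alpha> \<beta> t. xeuler t = 0 \<and> t \<in> filt 3 \<and>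
    h - (dconst \<alpha> * P + dconst \<beta> * dprod P P + t) \<in> filt 4)"

lemma trunc_form_0: "trunc_form P 0"
  unfolding trunc_form_def by (intro exI[of _ 0]) simp

lemma trunc_form_base: "trunc_form P P"
  unfolding trunc_form_def by (rule exI[of _ 1], (rule exI[of _ 0])+) simp

lemma trunc_form_add:
  assumes "trunc_form P f" "trunc_form P g"
  shows "trunc_form P (f + g)"
proof -
  obtain a b t a' b' t' where *: "xeuler t = 0" "t \<in> filt 3" "xeuler t' = 0" "t' \<in> filt 3"
    "f - (dconst a * P + dconst b * dprod P P + t) \<in> filt 4"
    "g - (dconst a' * P + dconst b' * dprod P P + t') \<in> filt 4"
    using assms unfolding trunc_form_def by blast
  show ?thesis
    unfolding trunc_form_def
  proof (intro exI conjI)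
    show "xeuler (t + t') = 0" "t + t' \<in> filt 3"
      using * by (simp_all add: filt_add)
    show "f + g - (dconst (a + a') * P + dconst (b + b') * dprod P P + (t + t')) \<in> filt 4"
      using filt_add[OF *(5,6)] by (simp add: dconst_add algebra_simps)
  qed
qed

lemma trunc_form_scale:
  assumes "trunc_form P f"
  shows "trunc_form P (dconst c * f)"
proof -
  obtain a b t where *: "xeuler t = 0" "t \<in> filt 3"
    "f - (dconst a * P + dconst b * dprod P P + t) \<in> filt 4"
    using assms unfolding trunc_form_def by blast
  show ?thesis
    unfolding trunc_form_def
  proof (intro exI conjI)
    show "xeuler (dconst c * t) = 0" "dconst c * t \<in> filt 3"
      using * by (simp_all add: filt_mult_right)
    show "dconst c * f - (dconst (c * a) * P + dconst (c * b) * dprod P P + dconst c * t) \<in> filt 4"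
      using filt_mult_right[OF *(3), of "dconst c"]
      by (simp only: dconst_mult mult.assoc distrib_left right_diff_distrib)
  qed
qed

lemma dprod_add_left: "dprod (f + g) h = dprod f h + dprod g h"
  and dprod_add_right: "dprod f (g + h) = dprod f g + dprod f h"
  and dprod_scale_left: "dprod (dconst c * f) h = dconst c * dprod f h"
  and dprod_scale_right: "dprod f (dconst c * h) = dconst c * dprod f h"
  by (simp_all add: dprod_def delta_add delta_mult algebra_simps)

text \<open>
  In the product of \<open>a P + b P \<circ> P + u\<close> and \<open>a' P + b' P \<circ> P + v\<close> with \<open>u\<close>, \<open>v\<close> of order at least \<open>3\<close>,
  the only terms of order below \<open>4\<close> are \<open>P \<circ> P\<close>, which has the required shape, and two triple products
  of \<open>P\<close>, in which replacing \<open>P\<close> by its linear part \<open>p\<close> changes only terms of order at least \<open>4\<close>.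
\<close>

lemma trunc_form_dprod:
  assumes p: "xeuler p = 0" "p \<in> filt 1" and Pp: "P - p \<in> filt 2"
    and f: "trunc_form P f" and g: "trunc_form P g"
  shows "trunc_form P (dprod f g)"
proof -
  obtain a b t a' b' t' where *: "t \<in> filt 3" "t' \<in> filt 3"
    "f - (dconst a * P + dconst b * dprod P P + t) \<in> filt 4"
    "g - (dconst a' * P + dconst b' * dprod P P + t') \<in> filt 4"
    using f g unfolding trunc_form_def by blast
  define r where "r = P - p"
  define u where "u = f - (dconst a * P + dconst b * dprod P P)"
  define v where "v = g - (dconst a' * P + dconst b' * dprod P P)"
  have r: "r \<in> filt 2" using Pp by (simp add: r_def)
  have P: "P = p + r" by (simp add: r_def)
  have P1: "P \<in> filt 1"
    unfolding P using p(2) filt_mono[OF r, of 1] by (simp add: filt_add)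
  have u: "u \<in> filt 3"
  proof -
    have "u = f - (dconst a * P + dconst b * dprod P P + t) + t"
      by (simp add: u_def algebra_simps)
    then show ?thesis
      using filt_add[OF filt_mono[OF *(3), of 3] *(1)] by simp
  qed
  have v: "v \<in> filt 3"
  proof -
    have "v = g - (dconst a' * P + dconst b' * dprod P P + t') + t'"
      by (simp add: v_def algebra_simps)
    then show ?thesis
      using filt_add[OF filt_mono[OF *(4), of 3] *(2)] by simp
  qed
  have f_eq: "f = dconst a * P + dconst b * dprod P P + u" 
    and g_eq: "g = dconst a' * P + dconst b' * dprod P P + v"
    by (simp_all add: u_def v_def)
  have p2: "dprod p p \<in> filt 2" and P2: "dprod P P \<in> filt 2"
    by (rule dprod_filt_le[OF p(2,2)], simp) (rule dprod_filt_le[OF P1 P1], simp)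
  have v1: "v \<in> filt 1" and g1: "g \<in> filt 1"
    using filt_mono[OF v, of 1] filt_mono[OF P2, of 1] P1 unfolding g_eq
    by (auto intro!: filt_add filt_mult_right)
  have diff2: "dprod P P - dprod p p \<in> filt 3"
  proof -
    have "dprod P P - dprod p p = dprod p r + dprod r P"
      by (simp add: P dprod_add_left dprod_add_right)
    also have "\<dots> \<in> filt 3"
      by (intro filt_add dprod_filt_le[OF p(2) r] dprod_filt_le[OF r P1]) simp_all
    finally show ?thesis .
  qed
  have diff3: "dprod P (dprod P P) - dprod p (dprod p p) \<in> filt 4"
  proof -
    have "dprod P (dprod P P) - dprod p (dprod p p) =
        dprod P (dprod P P - dprod p p) + dprod r (dprod p p)"
      by (simp add: dprod_def delta_diff r_def algebra_simps)
    also have "\<dots> \<in> filt 4"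
      by (intro filt_add dprod_filt_le[OF P1 diff2] dprod_filt_le[OF r p2]) simp_all
    finally show ?thesis .
  qed
  have diff3': "dprod (dprod P P) P - dprod (dprod p p) p \<in> filt 4"
  proof -
    have "dprod (dprod P P) P - dprod (dprod p p) p =
        dprod (dprod P P - dprod p p) P + dprod (dprod p p) r"
      by (simp add: dprod_def delta_diff r_def algebra_simps)
    also have "\<dots> \<in> filt 4"
      by (intro filt_add dprod_filt_le[OF diff2 P1] dprod_filt_le[OF p2 r]) simp_all
    finally show ?thesis .
  qed
  define s where "s = dconst (a * b') * dprod p (dprod p p) + dconst (b * a') * dprod (dprod p p) p"
  show ?thesis
    unfolding trunc_form_def
  proof (intro exI conjI)
    show "xeuler s = 0"
      by (simp add: s_def xeuler_dprod p)
    show "s \<in> filt 3"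
      unfolding s_def
      by (intro filt_add filt_mult_right dprod_filt_le[OF p(2) p2] dprod_filt_le[OF p2 p(2)]) simp_all
    have "dprod f g - (dconst 0 * P + dconst (a * a') * dprod P P + s) =
       dconst (a * b') * (dprod P (dprod P P) - dprod p (dprod p p)) +
       dconst (b * a') * (dprod (dprod P P) P - dprod (dprod p p) p) +
       dconst (b * b') * dprod (dprod P P) (dprod P P) +
       (dconst a * dprod P v + dconst b * dprod (dprod P P) v + dprod u g)"
      unfolding f_eq g_eq s_def dprod_add_left dprod_add_right dprod_scale_left dprod_scale_right
        dconst_mult
      by (simp add: algebra_simps)
    also have "\<dots> \<in> filt 4"
      by (intro filt_add filt_mult_right diff3 diff3' dprod_filt_le[OF P2 P2] dprod_filt_le[OF P1 v] dprod_filt_le[OF P2 v] dprod_filt_le[OF u g1])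
        simp_all
    finally show "dprod f g - (dconst 0 * P + dconst (a * a') * dprod P P + s) \<in> filt 4" .
  qed
qed

lemma automorphism_trunc_form:
  assumes aut: "automorphism \<phi>" and p: "xeuler p = 0" "p \<in> filt 1" "bod (\<phi> (nvar Z)) - p \<in> filt 2"
    and g: "g \<in> nsubalg {nvar Z}"
  shows "trunc_form (bod (\<phi> (nvar Z))) (bod (\<phi> g))"
  using g
proof (induction rule: nsubalg.induct)
  case one
  then show ?case using aut by (simp add: automorphism_iff trunc_form_0)
next
  case (base f)
  then show ?case by (simp add: trunc_form_base)
next
  case (prod f g)
  have "\<phi> (f \<circ>\<^sub>N g) = \<phi> f \<circ>\<^sub>N \<phi> g"
    using aut by (simp add: automorphism_iff)
  then show ?case
    using prod by (simp add: trunc_form_add trunc_form_scale trunc_form_dprod[OF p])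
qed (use aut in \<open>simp_all add: automorphism_iff trunc_form_add trunc_form_scale\<close>)

text \<open>The identity map is an automorphism, so this is a special case of the lemma on automorphisms.\<close>

lemma linear_part:
  assumes "f \<in> N0"
  obtains a b c where "f - lin a b c \<in> filt 2"
proof -
  have "automorphism (\<lambda>f :: 'a novikov. f)"
    using bij_id by (simp add: automorphism_iff id_def)
  from automorphism_linear_part[OF this, of "emb f"] show ?thesis
    using assms that by auto
qed

lemma not_triangulable:
  fixes D :: "'k::field_char_0 novikov \<Rightarrow> 'k novikov"
  assumes D: "has_values D (2 *\<^sub>N (nvar Y \<circ>\<^sub>N w0)) (nvar Z \<circ>\<^sub>N w0) 0"
  shows "\<not> triangulable D"
proof
  assume "triangulable D"
  then obtain \<phi> where aut: "automorphism \<phi>" and tri: "triangular (inv \<phi> \<circ> D \<circ> \<phi>)"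
    by (auto simp: triangulable_def)
  define P where "P = bod (\<phi> (nvar Z))"
  define Q where "Q = bod (\<phi> (nvar Y))"
  define h where "h = prolong (\<lambda>v. bod (D (nvar v)))"
  have der: "derivation D" and DX: "D (nvar X) = 2 *\<^sub>N (nvar Y \<circ>\<^sub>N w0)"
    and DY: "D (nvar Y) = nvar Z \<circ>\<^sub>N w0" and DZ: "D (nvar Z) = 0"
    using D by (simp_all add: has_values_def)
  have cst_D_var: "cst (D (nvar v)) = 0" for v
    by (cases v) (simp_all add: DX DY DZ)
  have cst_D: "cst (D f) = 0" and bod_D: "bod (D f) = der h (bod f)" for f
    unfolding h_def by (rule derivation_bod[OF der cst_D_var])+
  have cst_w0: "cst (w0 :: 'k novikov) = 0"
    by (simp add: w0_def)
  have w0: "bod (w0 :: 'k novikov) \<in> filt 2"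
  proof -
    have "dprod (dvar v 0) (dvar w 0) \<in> filt 2" for v w
      by (rule dprod_filt_le[OF dvar_filt dvar_filt]) simp
    then show ?thesis
      unfolding w0_def by (simp, intro filt_mult_right filt_diff)
  qed
  have hvar: "bod (D (nvar v)) \<in> filt 3" for v
  proof -
    have "dprod (dvar u 0) (bod (w0 :: 'k novikov)) \<in> filt 3" for u
      by (rule dprod_filt_le[OF dvar_filt w0]) simp
    then show ?thesis
      by (cases v) (simp_all add: DX DY DZ cst_w0 filt_mult_right)
  qed
  then have h: "h u \<in> filt 3" for u
    unfolding h_def by (rule prolong_filt)
  have D_filt: "der h f \<in> filt 4" if "f \<in> filt 2" for f
    using der_filt[of h 3 f 1] h that by (simp add: numeral_2_eq_2)
  have D_filt3: "der h f \<in> filt 3" if "f \<in> filt 1" for f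
    using der_filt[of h 3 f 0] h that by simp
  have h_lin: "der h (lin a b c) = (dconst (2 * a) * dvar Y 0 + dconst b * dvar Z 0) * delta (bod w0)"
    for a b c
    by (simp add: lin_def h_def prolong_def DX DY DZ cst_w0 dprod_def dconst_mult algebra_simps)

  \<comment> \<open>The linear part of \<open>\<phi> z\<close> is a nonzero multiple of \<open>z\<close>.\<close>
  have \<phi>_inv: "\<phi> (inv \<phi> f) = f" for f
    using aut by (simp add: automorphism_iff bij_is_surj surj_f_inv_f)
  obtain e where e: "inv \<phi> (D (\<phi> (nvar Z))) = e *\<^sub>N 1"
    using tri unfolding triangular_def by auto
  have "D (\<phi> (nvar Z)) = e *\<^sub>N 1"
    using aut \<phi>_inv[of "D (\<phi> (nvar Z))"] unfolding e by (simp add: automorphism_iff)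
  then have DP: "der h P = 0"
    using bod_D[of "\<phi> (nvar Z)"] by (simp add: P_def)
  obtain a b c where abc: "P - lin a b c \<in> filt 2"
    using linear_part[OF bod_N0] unfolding P_def by blast
  have "(dconst (2 * a) * dvar Y 0 + dconst b * dvar Z 0) * delta (bod w0) - 0 \<in> filt 4"
    using filt_minus[OF D_filt[OF abc]] by (simp add: DP h_lin)
  then have ab: "a = 0" "b = 0"
    using w0_leading_part[of 0 a b] by simp_all
  have c: "c \<noteq> 0"
  proof
    assume "c = 0"
    then have "bod (\<phi> (nvar Z)) \<in> filt 2"
      using abc by (simp add: ab lin_def P_def)
    then have "lin 0 0 1 \<in> (filt 2 :: 'k dpoly set)"
      by (simp add: automorphism_filt_2_iff[OF aut] lin_def)
    then have "(1 :: 'k) = 0"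
      by (rule lin_filt_2)
    then show False by simp
  qed
  define p where "p = lin 0 0 c"
  have p: "xeuler p = 0" "p \<in> filt 1" "bod (\<phi> (nvar Z)) - p \<in> filt 2"
    using abc by (simp_all add: p_def lin_filt ab P_def del: One_nat_def) (simp add: lin_def)

  \<comment> \<open>As \<open>D (\<phi> y)\<close> has order at least \<open>3\<close>, the coefficients \<open>\<alpha>\<close> and \<open>\<beta>\<close> of \<open>P\<close> and \<open>P \<circ> P\<close> vanish,
    which leaves a cubic part in the kernel of the Euler operator.\<close>
  have "trunc_form P (bod (D (\<phi> (nvar Y))))"
    using automorphism_trunc_form[OF aut p, of "inv \<phi> (D (\<phi> (nvar Y)))"] tri
    by (simp add: \<phi>_inv P_def triangular_def)
  then obtain \<alpha> \<beta> t where t: "xeuler t = 0" "t \<in> filt 3"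
    "der h Q - (dconst \<alpha> * P + dconst \<beta> * dprod P P + t) \<in> filt 4"
    unfolding trunc_form_def bod_D Q_def by blast
  obtain a' b' c' where abc': "Q - lin a' b' c' \<in> filt 2"
    using linear_part[OF bod_N0] unfolding Q_def by blast
  have Q3: "der h Q \<in> filt 3"
    unfolding Q_def by (intro D_filt3 N0_filt bod_N0)
  have P1: "P \<in> filt 1"
    unfolding P_def by (intro N0_filt bod_N0)
  have P2: "dprod P P \<in> filt 2"
    by (rule dprod_filt_le[OF P1 P1]) simp
  define s where "s = der h Q - (dconst \<alpha> * P + dconst \<beta> * dprod P P + t)"
  have s: "s \<in> filt 4" using t(3) by (simp add: s_def)
  have \<alpha>: "\<alpha> = 0"
  proof -
    have "lin 0 0 (\<alpha> * c) = (der h Q - t - s) - dconst \<beta> * dprod P P - dconst \<alpha> * (P - lin a b c)"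
      by (simp add: s_def lin_def ab dconst_mult algebra_simps)
    also have "\<dots> \<in> filt 2"
      by (intro filt_diff filt_mult_right P2 abc filt_mono[OF Q3] filt_mono[OF t(2)] filt_mono[OF s])
        simp_all
    finally have "\<alpha> * c = 0"
      by (rule lin_filt_2)
    then show ?thesis
      using c by simp
  qed
  have \<beta>: "\<beta> = 0"
  proof -
    define r where "r = P - p"
    have r: "r \<in> filt 2"
      using p(3) by (simp add: r_def P_def)
    have P: "P = p + r" by (simp add: r_def)
    have "dconst (\<beta> * c * c) * (dvar Z 0 * dvar Z 1) = dconst \<beta> * dprod p p"
      by (simp add: p_def lin_def dprod_def delta_mult dconst_mult algebra_simps)
    also have "\<dots> = (der h Q - t - s) - dconst \<beta> * (dprod p r + dprod r P)"
      by (simp add: s_def \<alpha> P dprod_add_left dprod_add_right algebra_simps)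
    also have "\<dots> \<in> filt 3"
      by (intro filt_diff filt_mult_right filt_add Q3 t(2) filt_mono[OF s]
          dprod_filt_le[OF p(2) r] dprod_filt_le[OF r P1]) simp_all
    finally have "pd Z 1 (dconst (\<beta> * c * c) * (dvar Z 0 * dvar Z 1)) \<in> filt 2"
      by (intro pd_filt) (simp add: numeral_3_eq_3 numeral_2_eq_2)
    then have "lin 0 0 (\<beta> * c * c) \<in> filt 2"
      by (simp add: lin_def)
    then have "\<beta> * c * c = 0"
      by (rule lin_filt_2)
    then show ?thesis
      using c by simp
  qed
  have "der h Q - t \<in> filt 4"
    using s by (simp add: s_def \<alpha> \<beta>)
  then have "der h Q - t - der h (Q - lin a' b' c') \<in> filt 4"
    using D_filt[OF abc'] by (rule filt_diff)
  then have "(dconst (2 * a') * dvar Y 0 + dconst b' * dvar Z 0) * delta (bod w0) - t \<in> filt 4"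
    by (simp add: h_lin algebra_simps)
  then have ab': "a' = 0" "b' = 0"
    using w0_leading_part[OF t(1)] by blast+

  \<comment> \<open>The linear parts of \<open>\<phi> y\<close> and \<open>\<phi> z\<close> are now \<open>c' z\<close> and \<open>c z\<close>, so this combination has none.\<close>
  have "bod (\<phi> (nvar Y - (c' / c) *\<^sub>N nvar Z)) = Q - dconst (c' / c) * P"
  proof -
    have "\<phi> (nvar Y) = \<phi> ((nvar Y - (c' / c) *\<^sub>N nvar Z) + (c' / c) *\<^sub>N nvar Z)"
      by simp
    also have "\<dots> = \<phi> (nvar Y - (c' / c) *\<^sub>N nvar Z) + (c' / c) *\<^sub>N \<phi> (nvar Z)"
      using aut unfolding automorphism_iff by metis
    finally show ?thesis
      by (simp add: Q_def P_def)
  qed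
  also have "\<dots> = (Q - lin a' b' c') - dconst (c' / c) * (P - lin a b c)"
  proof -
    have "dconst (c' / c) * lin a b c = lin a' b' c'"
      using c by (simp add: ab ab' flip: lin_scale)
    then show ?thesis
      by (simp add: algebra_simps)
  qed
  also have "\<dots> \<in> filt 2"
    by (intro filt_diff filt_mult_right abc abc')
  finally have "lin 0 1 (- (c' / c)) \<in> filt 2"
    by (simp add: automorphism_filt_2_iff[OF aut] lin_def dconst_minus)
  then have "(1 :: 'k) = 0"
    by (rule lin_filt_2)
  then show False by simp
qed

theorem mainTheorem1:
  shows "(\<exists>!D :: 'k::field_char_0 novikov \<Rightarrow> 'k novikov.
            has_values D (2 *\<^sub>N (nvar Y \<circ>\<^sub>N w0)) (nvar Z \<circ>\<^sub>N w0) 0) \<and>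
         (\<forall>D\<^sub>1 :: 'k novikov \<Rightarrow> 'k novikov.
            has_values D\<^sub>1 (2 *\<^sub>N (nvar Y \<circ>\<^sub>N w0)) (nvar Z \<circ>\<^sub>N w0) 0 \<longrightarrow> \<not> triangulable D\<^sub>1)"
proof (intro conjI allI impI not_triangulable)
  let ?F = "case_var (2 *\<^sub>N (nvar Y \<circ>\<^sub>N w0)) (nvar Z \<circ>\<^sub>N w0) 0 :: var \<Rightarrow> 'k novikov"
  have F: "has_values D (?F X) (?F Y) (?F Z) \<longleftrightarrow> derivation D \<and> (\<forall>v. D (nvar v) = ?F v)"
    for D :: "'k novikov \<Rightarrow> 'k novikov"
    unfolding has_values_def by (metis var.exhaust)
  have cst: "cst (?F v) = 0" for v
    by (cases v) simp_all
  have "\<exists>!D. derivation D \<and> (\<forall>v. D (nvar v) = ?F v)"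
    using derivation_exists[of ?F] derivation_unique cst by (metis (no_types, lifting))
  then show "\<exists>!D :: 'k novikov \<Rightarrow> 'k novikov.
      has_values D (2 *\<^sub>N (nvar Y \<circ>\<^sub>N w0)) (nvar Z \<circ>\<^sub>N w0) 0"
    unfolding F[symmetric] by simp
qed

end
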